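(* Let $\boldsymbol{\Gamma}=\coprod_{i\in\mathbb{N}}\Gamma_i$ be a disjoint union of finite connected graphs $\Gamma_i$ with bounded valency, equipped with a proper metric $d$ whose restriction to each $\Gamma_i$ is the graph metric of $\Gamma_i$, such that $d(\Gamma_i,\Gamma_i^c)\to\infty$ and $|\Gamma_i|\to\infty$ as $i\to\infty$, where $\Gamma_i^c$ denotes the complement of $\Gamma_i$ in $\boldsymbol{\Gamma}$. If there exists a cocycle $\phi\in\mathcal{E}^0_Q(\boldsymbol{\Gamma},\ell^1(\boldsymbol{\Gamma}))$ such that $\pi_*(\phi)=\mathbf{1}_Q$, then $H_h^0(\{\Gamma_i\})$ is non-zero.
   Context: Graphs. A finite graph $\Gamma$ has a finite non-empty vertex set, also denoted $\Gamma$, and a set $E$ of directed edges; each $e\in E$ goes from its starting vertex $e^-$ to its end vertex $e^+$, edges are regarded as ordered pairs $(e^-,e^+)$, and there is an edge from $x$ to $y$ if and only if there is an edge from $y$ to $x$. $|\Gamma|$ denotes the number of vertices. The valency of a vertex is the number of directed edges starting at it; bounded valency means there is $k$ such that every vertex of every $\Gamma_i$ has valency at most $k$. The graph metric on a connected graph is the length of a shortest edge path. The points of $\boldsymbol{\Gamma}$ are the vertices of the $\Gamma_i$, and $d(A,B)=\inf\{d(a,b):a\in A,b\in B\}$. Cheeger cohomology. Let $E_i$ be the edge set of $\Gamma_i$. Let $C^0(\{\Gamma_i\})$ be the normed space of functions $f:\coprod_i\Gamma_i\to\mathbb{C}$ with $\|f\|=\sup_i\sum_{x\in\Gamma_i}|f(x)|<\infty$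 and $\sum_{x\in\Gamma_i}f(x)=0$ for every $i$. Let $C^1(\{\Gamma_i\})$ be the normed space of functions $g:\coprod_iE_i\to\mathbb{C}$ with $\|g\|=\sup_i\sum_{e\in E_i}|g(e)|<\infty$ and $\sum_{e\in E_i}g(e)=0$ for every $i$. The coboundary map $d:C^0(\{\Gamma_i\})\to C^1(\{\Gamma_i\})$ (not to be confused with the metric), $df(e)=f(e^+)-f(e^-)$, is bounded and linear. Quotient completion. For a vector space $V$ with a countable family of seminorms, $V_Q=\ell^\infty(\mathbb{N},V)/c_0(\mathbb{N},V)$ is the space of sequences in $V$ bounded in every seminorm, modulo sequences converging to $0$ in every seminorm. Let $C^p_Q(\{\Gamma_i\})$ be the quotient completion of $C^p(\{\Gamma_i\})$, $p=0,1$, with the map $d:C^0_Q(\{\Gamma_i\})\to C^1_Q(\{\Gamma_i\})$ induced by applying $d$ termwise. Then $H_h^0(\{\Gamma_i\})=\ker\bigl(d:C^0_Q(\{\Gamma_i\})\to C^1_Q(\{\Gamma_i\})\bigr)$ is the degree-zero Cheeger cohomology. Controlled cochains. For a metric space $X$ and $R>0$ put $\Delta_R^{p+1}=\{(x_0,\dots,x_p)\in X^{p+1}:d(x_i,x_j)\le R\text{ for all }i,j\}$. Let $V$ be $\ell^1(X)$ (complex-valued, with the usual support function) or $\mathbb{C}$ (with every element having empty support). $\mathcal{E}^p(X,V)$ is the space of functions $\phi:X^{p+1}\to V$ such that for all $R>0$, $\phi$ is bounded on $\Delta_R^{p+1}$ and there is $S>0$ such that for every $(x_0,\dots,x_p)\in\Delta_R^{p+1}$,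 $\mathrm{supp}(\phi(x_0,\dots,x_p))\subseteq B_S(x_i)$ for all $i$, where $B_S(x)$ is the ball of radius $S$ about $x$. It carries the seminorms $\|\phi\|_R=\sup\{\|\phi(\mathbf{x})\|_V:\mathbf{x}\in\Delta_R^{p+1}\}$ (integer $R$ suffice, giving a countable family). $\mathcal{E}^p_Q(X,V)$ is its quotient completion. The map $D:\mathcal{E}^0(X,V)\to\mathcal{E}^1(X,V)$, $D\phi(x_0,x_1)=\phi(x_1)-\phi(x_0)$, induces $D:\mathcal{E}^0_Q(X,V)\to\mathcal{E}^1_Q(X,V)$ termwise; $\phi\in\mathcal{E}^0_Q(X,V)$ is a cocycle if $D\phi=0$. The summation map $\pi:\ell^1(X)\to\mathbb{C}$, $\pi(\eta)=\sum_{x\in X}\eta(x)$, induces $\pi_*:\mathcal{E}^0_Q(X,\ell^1(X))\to\mathcal{E}^0_Q(X,\mathbb{C})$ by composing termwise with $\pi$. $\mathbf{1}_Q\in\mathcal{E}^0_Q(X,\mathbb{C})$ is the class of the constant sequence whose terms are all the constant function $1$ on $X$. *)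

theory Defs
  imports
    "HOL-Analysis.Analysis"
    "HOL-Library.Function_Algebras"
    "Graph_Theory.Digraph_Component"
    "Graph_Theory.Shortest_Path"
begin

section \<open>Quotient completions\<close>

text \<open>
  A vector space with a countable family of seminorms, as a subspace \<open>vecs\<close> of an ambient
  abelian group.  A normed space is the case in which the family is constant.
\<close>

record 'a seminormed =
  vecs :: "'a set"
  seminorm :: "nat \<Rightarrow> 'a \<Rightarrow> real"

definition bounded_seqs :: "'a seminormed \<Rightarrow> (nat \<Rightarrow> 'a) set" where
  "bounded_seqs V =
    {s. range s \<subseteq> vecs V \<and> (\<forall>k. bdd_above (range (\<lambda>n. seminorm V k (s n))))}"

definition null_seqs :: "'a seminormed \<Rightarrow> (nat \<Rightarrow> 'a) set" where
  "null_seqs V =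
    {s. range s \<subseteq> vecs V \<and> (\<forall>k. (\<lambda>n. seminorm V k (s n)) \<longlonglongrightarrow> 0)}"

definition null_rel :: "'a::ab_group_add seminormed \<Rightarrow> (nat \<Rightarrow> 'a) rel" where
  "null_rel V =
    {(s, t). s \<in> bounded_seqs V \<and> t \<in> bounded_seqs V \<and> (\<lambda>n. s n - t n) \<in> null_seqs V}"

definition quotient_completion :: "'a::ab_group_add seminormed \<Rightarrow> (nat \<Rightarrow> 'a) set set" where
  "quotient_completion V = bounded_seqs V // null_rel V"

definition qclass :: "'a::ab_group_add seminormed \<Rightarrow> (nat \<Rightarrow> 'a) \<Rightarrow> (nat \<Rightarrow> 'a) set" where
  "qclass V s = null_rel V `` {s}"

definition qzero :: "'a::ab_group_add seminormed \<Rightarrow> (nat \<Rightarrow> 'a) set" where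
  "qzero V = qclass V (\<lambda>_. 0)"

text \<open>
  The map induced termwise by \<open>T\<close> on classes; \<open>W\<close> is the codomain.  For a bounded linear \<open>T\<close> all
  members of the union coincide.
\<close>

definition qmap ::
  "'b::ab_group_add seminormed \<Rightarrow> ('a \<Rightarrow> 'b) \<Rightarrow> (nat \<Rightarrow> 'a) set \<Rightarrow> (nat \<Rightarrow> 'b) set" where
  "qmap W T X = (\<Union>s\<in>X. qclass W (T \<circ> s))"


section \<open>Cheeger cohomology\<close>

text \<open>
  For pairwise disjoint finite sets \<open>S i\<close>, functions on their union are represented by functions
  on the ambient type vanishing outside it.
\<close>

definition zero_sum_space :: "(nat \<Rightarrow> 'b set) \<Rightarrow> ('b \<Rightarrow> complex) seminormed" where
  "zero_sum_space S =
    \<lparr>vecs = {f. (\<forall>x. x \<notin> (\<Union>i. S i) \<longrightarrow> f x = 0)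
            \<and> bdd_above (range (\<lambda>i. \<Sum>x\<in>S i. cmod (f x)))
            \<and> (\<forall>i. (\<Sum>x\<in>S i. f x) = 0)},
     seminorm = (\<lambda>_ f. SUP i. \<Sum>x\<in>S i. cmod (f x))\<rparr>"

definition cheeger_C0 :: "(nat \<Rightarrow> 'v pair_pre_digraph) \<Rightarrow> ('v \<Rightarrow> complex) seminormed" where
  "cheeger_C0 \<Gamma> = zero_sum_space (\<lambda>i. pverts (\<Gamma> i))"

definition cheeger_C1 :: "(nat \<Rightarrow> 'v pair_pre_digraph) \<Rightarrow> ('v \<times> 'v \<Rightarrow> complex) seminormed" where
  "cheeger_C1 \<Gamma> = zero_sum_space (\<lambda>i. parcs (\<Gamma> i))"

definition coboundary ::
  "(nat \<Rightarrow> 'v pair_pre_digraph) \<Rightarrow> ('v \<Rightarrow> complex) \<Rightarrow> 'v \<times> 'v \<Rightarrow> complex" where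
  "coboundary \<Gamma> f e = (if e \<in> (\<Union>i. parcs (\<Gamma> i)) then f (snd e) - f (fst e) else 0)"

definition cheeger_H0 :: "(nat \<Rightarrow> 'v pair_pre_digraph) \<Rightarrow> (nat \<Rightarrow> 'v \<Rightarrow> complex) set set" where
  "cheeger_H0 \<Gamma> =
    {h \<in> quotient_completion (cheeger_C0 \<Gamma>).
       qmap (cheeger_C1 \<Gamma>) (coboundary \<Gamma>) h = qzero (cheeger_C1 \<Gamma>)}"


section \<open>Controlled cochains\<close>

record ('w, 'x) coeffs =
  cvecs :: "'w set"
  cnorm :: "'w \<Rightarrow> real"
  csupp :: "'w \<Rightarrow> 'x set"

definition ell1 :: "('x \<Rightarrow> complex, 'x) coeffs" where
  "ell1 = \<lparr>cvecs = {\<eta>. (\<lambda>x. cmod (\<eta> x)) summable_on UNIV},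
           cnorm = (\<lambda>\<eta>. \<Sum>\<^sub>\<infinity>x. cmod (\<eta> x)),
           csupp = (\<lambda>\<eta>. {x. \<eta> x \<noteq> 0})\<rparr>"

definition scalars :: "(complex, 'x) coeffs" where
  "scalars = \<lparr>cvecs = UNIV, cnorm = cmod, csupp = (\<lambda>_. {})\<rparr>"

text \<open>
  Tuples of points form a type \<open>'t\<close>, and \<open>pts\<close> gives the set of entries of a tuple: single points
  in degree 0, pairs in degree 1.
\<close>

definition tuples_within :: "('t \<Rightarrow> 'x::metric_space set) \<Rightarrow> real \<Rightarrow> 't set" where
  "tuples_within pts R = {t. \<forall>x\<in>pts t. \<forall>y\<in>pts t. dist x y \<le> R}"

text \<open>The seminorms are those of the positive integer radii \<open>R = k + 1\<close>.\<close>

definition controlled ::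
  "('t \<Rightarrow> 'x::metric_space set) \<Rightarrow> ('w, 'x) coeffs \<Rightarrow> ('t \<Rightarrow> 'w) seminormed" where
  "controlled pts V =
    \<lparr>vecs = {\<phi>. range \<phi> \<subseteq> cvecs V
            \<and> (\<forall>R>0. bdd_above ((\<lambda>t. cnorm V (\<phi> t)) ` tuples_within pts R)
                 \<and> (\<exists>S>0. \<forall>t\<in>tuples_within pts R. \<forall>x\<in>pts t. csupp V (\<phi> t) \<subseteq> ball x S))},
     seminorm = (\<lambda>k \<phi>. SUP t\<in>tuples_within pts (real (Suc k)). cnorm V (\<phi> t))\<rparr>"

definition controlled0 :: "('w, 'x::metric_space) coeffs \<Rightarrow> ('x \<Rightarrow> 'w) seminormed" where
  "controlled0 = controlled (\<lambda>x. {x})"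

definition controlled1 :: "('w, 'x::metric_space) coeffs \<Rightarrow> ('x \<times> 'x \<Rightarrow> 'w) seminormed" where
  "controlled1 = controlled (\<lambda>(x, y). {x, y})"

definition D0 :: "('x \<Rightarrow> 'w::ab_group_add) \<Rightarrow> 'x \<times> 'x \<Rightarrow> 'w" where
  "D0 \<phi> = (\<lambda>(x0, x1). \<phi> x1 - \<phi> x0)"

definition cocycle0 ::
  "('w::ab_group_add, 'x::metric_space) coeffs \<Rightarrow> (nat \<Rightarrow> 'x \<Rightarrow> 'w) set \<Rightarrow> bool" where
  "cocycle0 V \<phi> \<longleftrightarrow>
    \<phi> \<in> quotient_completion (controlled0 V) \<and>
    qmap (controlled1 V) D0 \<phi> = qzero (controlled1 V)"

definition summation :: "('x \<Rightarrow> complex) \<Rightarrow> complex" where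
  "summation \<eta> = (\<Sum>\<^sub>\<infinity>x. \<eta> x)"

definition pi_star ::
  "(nat \<Rightarrow> 'x \<Rightarrow> 'x \<Rightarrow> complex) set \<Rightarrow> (nat \<Rightarrow> 'x::metric_space \<Rightarrow> complex) set" where
  "pi_star = qmap (controlled0 scalars) (\<lambda>\<phi>. summation \<circ> \<phi>)"

definition one_Q :: "(nat \<Rightarrow> 'x::metric_space \<Rightarrow> complex) set" where
  "one_Q = qclass (controlled0 scalars) (\<lambda>_ _. 1)"

end

theory Submission
  imports Defs
begin

text \<open>
  Average the cocycle over columns: for large \<open>i\<close> the kernel \<open>(x, z) \<mapsto> \<phi>\<^sub>n(x)(z)\<close> on
  \<open>\<Gamma>\<^sub>i \<times> \<Gamma>\<^sub>i\<close> has total mass comparable to \<open>|\<Gamma>\<^sub>i|\<close>, while its total variation along edges in \<open>x\<close>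
  is at most a small multiple of \<open>|\<Gamma>\<^sub>i|\<close>.  By pigeonhole some column \<open>x \<mapsto> |\<phi>\<^sub>n(x)(z)|\<close> has small
  coboundary relative to its norm.  Its support lies in a ball about \<open>z\<close> of radius independent of
  \<open>i\<close>, hence it is far from the constants when \<open>|\<Gamma>\<^sub>i|\<close> is large, so subtracting the mean leaves a
  vector of norm bounded below.  For each \<open>n\<close> a single \<open>\<Gamma>\<^sub>i\<close> suffices, because the norm is
  a supremum over \<open>i\<close>.
\<close>

section \<open>Quotient completions of seminormed spaces\<close>

text \<open>Everything is phrased through differences: \<open>x - x\<close> gives nonnegativity and
  \<open>0 - x\<close> gives negation, so null sequences are closed under differences and the
  quotient makes sense.\<close>

locale seminormed_space =
  fixes V :: "'a::ab_group_add seminormed"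
  assumes zero_mem: "0 \<in> vecs V"
    and diff_mem: "x \<in> vecs V \<Longrightarrow> y \<in> vecs V \<Longrightarrow> x - y \<in> vecs V"
    and seminorm_zero: "seminorm V k 0 = 0"
    and seminorm_diff_le:
      "x \<in> vecs V \<Longrightarrow> y \<in> vecs V \<Longrightarrow> seminorm V k (x - y) \<le> seminorm V k x + seminorm V k y"
begin

lemma seminorm_nonneg: "x \<in> vecs V \<Longrightarrow> 0 \<le> seminorm V k x"
  using seminorm_diff_le[of x x k] seminorm_zero[of k] by simp

lemma zero_in_null_seqs: "(\<lambda>_. 0) \<in> null_seqs V"
  by (auto simp: null_seqs_def zero_mem seminorm_zero)

lemma zero_in_bounded_seqs: "(\<lambda>_. 0) \<in> bounded_seqs V"
  by (auto simp: bounded_seqs_def zero_mem)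

lemma null_seqs_diff:
  assumes "s \<in> null_seqs V" "t \<in> null_seqs V"
  shows "(\<lambda>n. s n - t n) \<in> null_seqs V"
proof -
  have mem: "s n \<in> vecs V" "t n \<in> vecs V" for n
    using assms by (auto simp: null_seqs_def)
  have "(\<lambda>n. seminorm V k (s n - t n)) \<longlonglongrightarrow> 0" for k
  proof (rule tendsto_sandwich[OF _ _ tendsto_const])
    show "(\<lambda>n. seminorm V k (s n) + seminorm V k (t n)) \<longlonglongrightarrow> 0"
      using assms tendsto_add[of "\<lambda>n. seminorm V k (s n)" 0 _ "\<lambda>n. seminorm V k (t n)" 0]
      by (simp add: null_seqs_def)
  qed (auto simp: mem diff_mem seminorm_nonneg seminorm_diff_le)
  then show ?thesis
    using mem by (auto simp: null_seqs_def diff_mem)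
qed

lemma equiv_null_rel: "equiv (bounded_seqs V) (null_rel V)"
proof (rule equivI)
  show "null_rel V \<subseteq> bounded_seqs V \<times> bounded_seqs V"
    by (auto simp: null_rel_def)
  show "refl_on (bounded_seqs V) (null_rel V)"
    using zero_in_null_seqs by (auto simp: refl_on_def null_rel_def)
  show "sym (null_rel V)"
    using null_seqs_diff[OF zero_in_null_seqs] by (fastforce simp: sym_def null_rel_def)
  show "trans (null_rel V)"
  proof (rule transI)
    fix r s t assume rs: "(r, s) \<in> null_rel V" and st: "(s, t) \<in> null_rel V"
    \<comment> \<open>The second relation is reversed first, because \<open>r - t\<close> is
      obtained as \<open>(r - s) - (t - s)\<close>.\<close>
    have "(\<lambda>n. t n - s n) \<in> null_seqs V"
      using st null_seqs_diff[OF zero_in_null_seqs, of "\<lambda>n. s n - t n"] by (simp add: null_rel_def)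
    then show "(r, t) \<in> null_rel V"
      using rs st null_seqs_diff[of "\<lambda>n. r n - s n" "\<lambda>n. t n - s n"] by (simp add: null_rel_def)
  qed
qed

lemma qclass_in_quotient_completion: "s \<in> bounded_seqs V \<Longrightarrow> qclass V s \<in> quotient_completion V"
  by (auto simp: qclass_def quotient_completion_def quotient_def)

lemma qclass_eq_iff:
  assumes "s \<in> bounded_seqs V" "t \<in> bounded_seqs V"
  shows "qclass V s = qclass V t \<longleftrightarrow> (\<lambda>n. s n - t n) \<in> null_seqs V"
  using assms eq_equiv_class_iff[OF equiv_null_rel] by (simp add: qclass_def null_rel_def)

lemma qclass_eq_qzero_iff:
  "s \<in> bounded_seqs V \<Longrightarrow> qclass V s = qzero V \<longleftrightarrow> s \<in> null_seqs V"
  by (simp add: qzero_def qclass_eq_iff zero_in_bounded_seqs)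

end

text \<open>By additivity and the seminorm bound, \<open>T\<close> sends null sequences to null
  sequences. All representatives therefore have images in one class, and the union defining
  \<open>qmap\<close> collapses to it.\<close>

lemma qmap_qclass:
  fixes V :: "'a::ab_group_add seminormed" and W :: "'b::ab_group_add seminormed"
  assumes V: "seminormed_space V" and W: "seminormed_space W"
    and mem: "\<And>x. x \<in> vecs V \<Longrightarrow> T x \<in> vecs W"
    and diff: "\<And>x y. x \<in> vecs V \<Longrightarrow> y \<in> vecs V \<Longrightarrow> T (x - y) = T x - T y"
    and bound: "\<And>k x. x \<in> vecs V \<Longrightarrow> seminorm W k (T x) \<le> C k * seminorm V (j k) x"
    and C: "\<And>k. 0 \<le> C k"
    and s: "s \<in> bounded_seqs V"
  shows "T \<circ> s \<in> bounded_seqs W" "qmap W T (qclass V s) = qclass W (T \<circ> s)"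
proof -
  interpret V: seminormed_space V by fact
  interpret W: seminormed_space W by fact
  have T_bounded: "T \<circ> t \<in> bounded_seqs W" if t: "t \<in> bounded_seqs V" for t
  proof -
    have tm: "t n \<in> vecs V" for n using t by (auto simp: bounded_seqs_def)
    have "bdd_above (range (\<lambda>n. seminorm W k (T (t n))))" for k
    proof -
      have "bdd_above (range (\<lambda>n. seminorm V (j k) (t n)))"
        using t by (simp add: bounded_seqs_def)
      then obtain B where B: "\<And>n. seminorm V (j k) (t n) \<le> B"
        by (auto simp: bdd_above_def)
      show ?thesis
        using order_trans[OF bound[OF tm] mult_left_mono[OF B C]] by (intro bdd_aboveI2)
    qed
    then show ?thesis using tm mem by (auto simp: bounded_seqs_def)
  qed
  then show "T \<circ> s \<in> bounded_seqs W" using s .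
  have T_eq: "qclass W (T \<circ> t) = qclass W (T \<circ> s)" if "t \<in> qclass V s" for t
  proof -
    have t: "t \<in> bounded_seqs V" and null: "(\<lambda>n. s n - t n) \<in> null_seqs V"
      using that by (auto simp: qclass_def null_rel_def)
    have m: "s n \<in> vecs V" "t n \<in> vecs V" for n
      using s t by (auto simp: bounded_seqs_def)
    have "(\<lambda>n. seminorm W k (T (s n) - T (t n))) \<longlonglongrightarrow> 0" for k
    proof (rule tendsto_sandwich[OF _ _ tendsto_const])
      show "(\<lambda>n. C k * seminorm V (j k) (s n - t n)) \<longlonglongrightarrow> 0"
        using null tendsto_mult_right_zero by (force simp: null_seqs_def)
      show "\<forall>\<^sub>F n in sequentially. 0 \<le> seminorm W k (T (s n) - T (t n))"
        by (simp add: W.seminorm_nonneg W.diff_mem mem m)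
      show "\<forall>\<^sub>F n in sequentially.
          seminorm W k (T (s n) - T (t n)) \<le> C k * seminorm V (j k) (s n - t n)"
        using bound[OF V.diff_mem[OF m]] by (simp add: diff m)
    qed
    then have "(\<lambda>n. T (s n) - T (t n)) \<in> null_seqs W"
      by (auto simp: null_seqs_def W.diff_mem mem m)
    then show ?thesis
      using W.qclass_eq_iff[OF T_bounded[OF s] T_bounded[OF t]] by simp
  qed
  have "s \<in> qclass V s"
    using equiv_class_self[OF V.equiv_null_rel s] by (simp add: qclass_def)
  with T_eq show "qmap W T (qclass V s) = qclass W (T \<circ> s)"
    unfolding qmap_def by blast
qed

section \<open>The seminormed structure of the Cheeger cochain spaces\<close>

lemma seminormed_space_zero_sum_space: "seminormed_space (zero_sum_space S)"
proof
  fix f g :: "'a \<Rightarrow> complex" and k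
  assume f: "f \<in> vecs (zero_sum_space S)" and g: "g \<in> vecs (zero_sum_space S)"
  let ?n = "\<lambda>f i. \<Sum>x\<in>S i. cmod (f x)"
  have bf: "bdd_above (range (?n f))" and bg: "bdd_above (range (?n g))"
    using f g by (auto simp: zero_sum_space_def)
  have le: "?n (f - g) i \<le> (SUP i. ?n f i) + (SUP i. ?n g i)" for i
  proof -
    have "?n (f - g) i \<le> ?n f i + ?n g i"
      by (simp add: sum.distrib[symmetric] sum_mono norm_triangle_ineq4)
    also have "\<dots> \<le> (SUP i. ?n f i) + (SUP i. ?n g i)"
      by (intro add_mono cSUP_upper bf bg) auto
    finally show ?thesis .
  qed
  then show "seminorm (zero_sum_space S) k (f - g)
      \<le> seminorm (zero_sum_space S) k f + seminorm (zero_sum_space S) k g"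
    by (auto simp: zero_sum_space_def intro!: cSUP_least)
  show "f - g \<in> vecs (zero_sum_space S)"
    using f g le by (auto simp: zero_sum_space_def sum_subtractf intro!: bdd_aboveI2)
qed (auto simp: zero_sum_space_def)

section \<open>Finite graphs of bounded valency\<close>

context pair_fin_digraph
begin

text \<open>A walk of length at most \<open>n + 1\<close> is empty or starts with one of at most
  \<open>k\<close> arcs, so the count \<open>b\<close> satisfies
  \<open>b (n + 1) \<le> 1 + k * b n\<close>. The resulting bound does not depend on the size of the
  graph.\<close>

lemma card_walk_ball_le:
  assumes deg: "\<And>x. x \<in> pverts G \<Longrightarrow> out_degree (with_proj G) x \<le> k"
    and "x \<in> pverts G"
  shows "card {y. \<exists>p. awalk x p y \<and> length p \<le> n} \<le> Suc k ^ n"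
  using \<open>x \<in> pverts G\<close>
proof (induction n arbitrary: x)
  case 0
  have "{y. \<exists>p. awalk x p y \<and> length p \<le> 0} = {x}"
    using 0 by (auto simp: awalk_Nil_iff)
  then show ?case by simp
next
  case (Suc n)
  let ?W = "\<lambda>n x. {y. \<exists>p. awalk x p y \<and> length p \<le> n}"
  let ?O = "out_arcs (with_proj G) x"
  have finW: "finite (?W n y)" for n y
    by (rule finite_subset[OF _ pair_finite_verts]) (auto dest: awalk_last_in_verts)
  have "?W (Suc n) x \<subseteq> insert x (\<Union>e\<in>?O. ?W n (snd e))"
  proof
    fix y assume "y \<in> ?W (Suc n) x"
    then obtain p where p: "awalk x p y" "length p \<le> Suc n" by blast
    then show "y \<in> insert x (\<Union>e\<in>?O. ?W n (snd e))"
      by (cases p) (auto simp: awalk_simps)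
  qed
  then have "card (?W (Suc n) x) \<le> card (insert x (\<Union>e\<in>?O. ?W n (snd e)))"
    using finW by (intro card_mono) auto
  also have "\<dots> \<le> Suc (card (\<Union>e\<in>?O. ?W n (snd e)))"
    by (rule card_insert_le_m1) auto
  also have "card (\<Union>e\<in>?O. ?W n (snd e)) \<le> (\<Sum>e\<in>?O. card (?W n (snd e)))"
    by (rule card_UN_le) auto
  also have "\<dots> \<le> (\<Sum>e\<in>?O. Suc k ^ n)"
    using Suc.IH by (intro sum_mono) (auto simp: arc_snd_in_verts)
  also have "\<dots> \<le> k * Suc k ^ n"
    using deg[OF Suc.prems] by (simp add: out_degree_def)
  finally show ?case
    using one_le_power[of "Suc k" n] unfolding power_Suc mult_Suc by linarith
qed

text \<open>Grouping the arcs by tail counts each vertex \<open>x\<close> with multiplicity its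
  out-degree.\<close>

lemma sum_arcs_tail_le:
  fixes h :: "'a \<Rightarrow> real"
  assumes deg: "\<And>x. x \<in> pverts G \<Longrightarrow> out_degree (with_proj G) x \<le> k"
    and h: "\<And>x. x \<in> pverts G \<Longrightarrow> 0 \<le> h x"
  shows "(\<Sum>e\<in>parcs G. h (fst e)) \<le> k * (\<Sum>x\<in>pverts G. h x)"
proof -
  have "(\<Sum>e\<in>parcs G. h (fst e)) = (\<Sum>x\<in>pverts G. \<Sum>e | e \<in> parcs G \<and> fst e = x. h (fst e))"
    using pair_finite_arcs pair_finite_verts
    by (intro sum.group[symmetric]) (auto intro: in_arcsD1)
  also have "\<dots> = (\<Sum>x\<in>pverts G. out_degree (with_proj G) x * h x)"
    by (intro sum.cong) (auto simp: out_degree_def out_arcs_def)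
  also have "\<dots> \<le> (\<Sum>x\<in>pverts G. k * h x)"
    by (intro sum_mono mult_right_mono) (use deg h in auto)
  finally show ?thesis by (simp add: sum_distrib_left)
qed

lemma card_arcs_le:
  assumes "\<And>x. x \<in> pverts G \<Longrightarrow> out_degree (with_proj G) x \<le> k"
  shows "card (parcs G) \<le> k * card (pverts G)"
  using sum_arcs_tail_le[of k "\<lambda>_. 1"] assms by (simp flip: of_nat_mult)

end

text \<open>Reversal of arcs is an involution of the arc set, which exchanges heads and
  tails.\<close>

lemma (in pair_pseudo_graph) sum_arcs_swap:
  "(\<Sum>e\<in>parcs G. h (snd e)) = (\<Sum>e\<in>parcs G. h (fst e))"
proof -
  have "(u, v) \<in> parcs G \<longleftrightarrow> (v, u) \<in> parcs G" for u v
    using pair_sym_arcs unfolding symmetric_def by (auto dest: symD)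
  then show ?thesis
    by (intro sum.reindex_bij_witness[of _ prod.swap prod.swap]) auto
qed

section \<open>The coboundary map\<close>

context
  fixes \<Gamma> :: "nat \<Rightarrow> 'v pair_pre_digraph" and k :: nat
  assumes graphs: "\<And>i. pair_pseudo_graph (\<Gamma> i)"
    and valency: "\<And>i x. x \<in> pverts (\<Gamma> i) \<Longrightarrow> out_degree (with_proj (\<Gamma> i)) x \<le> k"
begin

lemma sum_norm_coboundary_le:
  "(\<Sum>e\<in>parcs (\<Gamma> i). cmod (coboundary \<Gamma> f e)) \<le> 2 * k * (\<Sum>x\<in>pverts (\<Gamma> i). cmod (f x))"
proof -
  interpret pair_pseudo_graph "\<Gamma> i" by (rule graphs)
  have "(\<Sum>e\<in>parcs (\<Gamma> i). cmod (coboundary \<Gamma> f e))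
      \<le> (\<Sum>e\<in>parcs (\<Gamma> i). cmod (f (snd e)) + cmod (f (fst e)))"
    by (intro sum_mono) (auto simp: coboundary_def norm_triangle_ineq4)
  also have "\<dots> = 2 * (\<Sum>e\<in>parcs (\<Gamma> i). cmod (f (fst e)))"
    by (simp add: sum.distrib sum_arcs_swap[of "\<lambda>x. cmod (f x)"])
  also have "\<dots> \<le> 2 * (k * (\<Sum>x\<in>pverts (\<Gamma> i). cmod (f x)))"
    by (intro mult_left_mono sum_arcs_tail_le valency) auto
  finally show ?thesis by simp
qed

lemma sum_coboundary: "(\<Sum>e\<in>parcs (\<Gamma> i). coboundary \<Gamma> f e) = 0"
proof -
  interpret pair_pseudo_graph "\<Gamma> i" by (rule graphs)
  have "(\<Sum>e\<in>parcs (\<Gamma> i). coboundary \<Gamma> f e) = (\<Sum>e\<in>parcs (\<Gamma> i). f (snd e) - f (fst e))"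
    by (intro sum.cong) (auto simp: coboundary_def)
  then show ?thesis by (simp add: sum_subtractf sum_arcs_swap)
qed

lemma coboundary_bound:
  assumes "f \<in> vecs (cheeger_C0 \<Gamma>)"
  shows "coboundary \<Gamma> f \<in> vecs (cheeger_C1 \<Gamma>)"
    and "seminorm (cheeger_C1 \<Gamma>) m (coboundary \<Gamma> f) \<le> 2 * k * seminorm (cheeger_C0 \<Gamma>) m f"
proof -
  have bdd: "bdd_above (range (\<lambda>i. \<Sum>x\<in>pverts (\<Gamma> i). cmod (f x)))"
    using assms by (simp add: cheeger_C0_def zero_sum_space_def)
  have le: "(\<Sum>e\<in>parcs (\<Gamma> i). cmod (coboundary \<Gamma> f e))
      \<le> 2 * k * (SUP i. \<Sum>x\<in>pverts (\<Gamma> i). cmod (f x))" for i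
    using sum_norm_coboundary_le
    by (rule order_trans) (intro mult_left_mono cSUP_upper bdd; simp)
  show "coboundary \<Gamma> f \<in> vecs (cheeger_C1 \<Gamma>)"
    using le sum_coboundary
    by (auto simp: cheeger_C1_def zero_sum_space_def coboundary_def intro!: bdd_aboveI2)
  show "seminorm (cheeger_C1 \<Gamma>) m (coboundary \<Gamma> f) \<le> 2 * k * seminorm (cheeger_C0 \<Gamma>) m f"
    using le by (auto simp: cheeger_C0_def cheeger_C1_def zero_sum_space_def intro!: cSUP_least)
qed

lemma qmap_coboundary:
  assumes "s \<in> bounded_seqs (cheeger_C0 \<Gamma>)"
  shows "coboundary \<Gamma> \<circ> s \<in> bounded_seqs (cheeger_C1 \<Gamma>)"
    and "qmap (cheeger_C1 \<Gamma>) (coboundary \<Gamma>) (qclass (cheeger_C0 \<Gamma>) s)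
      = qclass (cheeger_C1 \<Gamma>) (coboundary \<Gamma> \<circ> s)"
proof -
  have spaces: "seminormed_space (cheeger_C0 \<Gamma>)" "seminormed_space (cheeger_C1 \<Gamma>)"
    by (simp_all add: cheeger_C0_def cheeger_C1_def seminormed_space_zero_sum_space)
  have "coboundary \<Gamma> (f - g) = coboundary \<Gamma> f - coboundary \<Gamma> g" for f g
    by (auto simp: coboundary_def)
  note * = qmap_qclass[of "cheeger_C0 \<Gamma>" "cheeger_C1 \<Gamma>" "coboundary \<Gamma>" "\<lambda>_. 2 * k" "\<lambda>m. m",
      OF spaces coboundary_bound(1) this coboundary_bound(2) _ assms]
  show "coboundary \<Gamma> \<circ> s \<in> bounded_seqs (cheeger_C1 \<Gamma>)"
    and "qmap (cheeger_C1 \<Gamma>) (coboundary \<Gamma>) (qclass (cheeger_C0 \<Gamma>) s)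
      = qclass (cheeger_C1 \<Gamma>) (coboundary \<Gamma> \<circ> s)"
    using * by simp_all
qed

text \<open>The upper bound makes \<open>s\<close> represent an element of the quotient completion,
  the limit puts its class into the kernel of the coboundary, and the lower bound keeps
  \<open>s\<close> from being a null sequence.\<close>

lemma cheeger_H0_nonzero:
  assumes C: "\<And>n. s n \<in> vecs (cheeger_C0 \<Gamma>)"
    and lower: "0 < c" "\<And>n. c \<le> seminorm (cheeger_C0 \<Gamma>) 0 (s n)"
    and upper: "\<And>n. seminorm (cheeger_C0 \<Gamma>) 0 (s n) \<le> b"
    and lim: "(\<lambda>n. seminorm (cheeger_C1 \<Gamma>) 0 (coboundary \<Gamma> (s n))) \<longlonglongrightarrow> 0"
  shows "\<exists>h\<in>cheeger_H0 \<Gamma>. h \<noteq> qzero (cheeger_C0 \<Gamma>)"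
proof
  interpret C0: seminormed_space "cheeger_C0 \<Gamma>"
    unfolding cheeger_C0_def by (rule seminormed_space_zero_sum_space)
  interpret C1: seminormed_space "cheeger_C1 \<Gamma>"
    unfolding cheeger_C1_def by (rule seminormed_space_zero_sum_space)
  \<comment> \<open>Both spaces are normed, with constant seminorm families, so the index 0 stands
    for all.\<close>
  have const: "seminorm (cheeger_C0 \<Gamma>) m = seminorm (cheeger_C0 \<Gamma>) 0"
    "seminorm (cheeger_C1 \<Gamma>) m = seminorm (cheeger_C1 \<Gamma>) 0" for m
    by (simp_all add: cheeger_C0_def cheeger_C1_def zero_sum_space_def)
  have s: "s \<in> bounded_seqs (cheeger_C0 \<Gamma>)"
  proof -
    have "bdd_above (range (\<lambda>n. seminorm (cheeger_C0 \<Gamma>) m (s n)))" for m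
      using upper by (intro bdd_aboveI2[of _ _ b]) (simp add: const(1)[of m])
    then show ?thesis using C by (auto simp: bounded_seqs_def)
  qed
  have "coboundary \<Gamma> \<circ> s \<in> null_seqs (cheeger_C1 \<Gamma>)"
  proof -
    have "(\<lambda>n. seminorm (cheeger_C1 \<Gamma>) m (coboundary \<Gamma> (s n))) \<longlonglongrightarrow> 0" for m
      using lim by (simp add: const(2)[of m])
    then show ?thesis using C coboundary_bound(1) by (auto simp: null_seqs_def)
  qed
  then show "qclass (cheeger_C0 \<Gamma>) s \<in> cheeger_H0 \<Gamma>"
    using qmap_coboundary[OF s]
    by (simp add: cheeger_H0_def C0.qclass_in_quotient_completion[OF s] C1.qclass_eq_qzero_iff)
  have "\<not> (\<lambda>n. seminorm (cheeger_C0 \<Gamma>) 0 (s n)) \<longlonglongrightarrow> 0"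
    using LIMSEQ_le_const[of _ 0 c] lower by fastforce
  then show "qclass (cheeger_C0 \<Gamma>) s \<noteq> qzero (cheeger_C0 \<Gamma>)"
    by (auto simp: C0.qclass_eq_qzero_iff[OF s] null_seqs_def)
qed

end

text \<open>By disjointness all sums over \<open>S j\<close> with \<open>j \<noteq> i\<close>
  vanish, so the supremum is attained at \<open>i\<close>.\<close>

lemma zero_sum_space_single:
  assumes disj: "disjoint_family S"
    and supp: "\<And>x. x \<notin> S i \<Longrightarrow> f x = 0" and zero: "(\<Sum>x\<in>S i. f x) = 0"
  shows "f \<in> vecs (zero_sum_space S)"
    and "seminorm (zero_sum_space S) k f = (\<Sum>x\<in>S i. cmod (f x))"
proof -
  have off: "f x = 0" if "x \<in> S j" "j \<noteq> i" for x j
    using that disj supp by (auto simp: disjoint_family_on_def)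
  have le: "(\<Sum>x\<in>S j. cmod (f x)) \<le> (\<Sum>x\<in>S i. cmod (f x))" for j
    by (cases "j = i") (auto simp: off sum_nonneg)
  have "(\<Sum>x\<in>S j. f x) = 0" for j
    using zero by (cases "j = i") (auto simp: off)
  with supp le show "f \<in> vecs (zero_sum_space S)"
    by (auto simp: zero_sum_space_def intro!: bdd_aboveI2)
  have "(SUP j. \<Sum>x\<in>S j. cmod (f x)) = (\<Sum>x\<in>S i. cmod (f x))"
    by (rule cSup_eq_maximum) (use le in auto)
  then show "seminorm (zero_sum_space S) k f = (\<Sum>x\<in>S i. cmod (f x))"
    by (simp add: zero_sum_space_def)
qed

section \<open>Almost invariant vectors\<close>

text \<open>Double counting: the columns have total mass at least \<open>card P / 2\<close> and
  total variation at most \<open>k * card P * \<delta>\<close>. If every column of positive mass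
  violated the claimed ratio, summation over the columns would contradict this; the factor 2 absorbs
  the mass bound \<open>1 / 2\<close>.\<close>

lemma almost_invariant_column:
  fixes u :: "'v \<Rightarrow> 'v \<Rightarrow> complex" and \<delta> :: real and k :: nat
  assumes P: "finite P" "P \<noteq> {}" and A: "finite A" "card A \<le> k * card P"
    and mass: "\<And>x. x \<in> P \<Longrightarrow> 1 / 2 \<le> (\<Sum>z\<in>P. cmod (u x z))"
    and var: "\<And>e. e \<in> A \<Longrightarrow> (\<Sum>z\<in>P. cmod (u (snd e) z - u (fst e) z)) \<le> \<delta>" and "0 \<le> \<delta>"
  obtains z where "z \<in> P" "0 < (\<Sum>x\<in>P. cmod (u x z))"
    "(\<Sum>e\<in>A. cmod (u (snd e) z - u (fst e) z)) \<le> 2 * k * \<delta> * (\<Sum>x\<in>P. cmod (u x z))"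
proof (rule ccontr)
  let ?a = "\<lambda>z. \<Sum>x\<in>P. cmod (u x z)"
  let ?d = "\<lambda>z. \<Sum>e\<in>A. cmod (u (snd e) z - u (fst e) z)"
  assume "\<not> thesis"
  with that have bad: "2 * k * \<delta> * ?a z < ?d z" if "z \<in> P" "0 < ?a z" for z
    using \<open>z \<in> P\<close> \<open>0 < ?a z\<close> by (meson not_le)
  have le: "2 * k * \<delta> * ?a z \<le> ?d z" if "z \<in> P" for z
  proof (cases "0 < ?a z")
    case True
    then show ?thesis using bad[OF that] by simp
  next
    case False
    then have "?a z = 0" by (meson antisym not_le sum_nonneg norm_ge_zero)
    then show ?thesis by (simp add: sum_nonneg)
  qed
  have "real (card P) / 2 \<le> (\<Sum>x\<in>P. \<Sum>z\<in>P. cmod (u x z))"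
    using sum_mono[of P "\<lambda>_. 1 / 2", OF mass] by simp
  also have swap: "\<dots> = (\<Sum>z\<in>P. ?a z)" by (rule sum.swap)
  finally have total: "real (card P) / 2 \<le> (\<Sum>z\<in>P. ?a z)" .
  \<comment> \<open>Columns of mass zero satisfy \<open>le\<close> only weakly; strictness of the
    summed inequality comes from one column of positive mass.\<close>
  have "0 < (\<Sum>z\<in>P. ?a z)"
    using total P by (smt (verit) card_gt_0_iff divide_pos_pos of_nat_0_less_iff)
  then obtain z where z: "z \<in> P" "0 < ?a z"
    by (meson not_le sum_nonpos)
  have "k * card P * \<delta> = 2 * k * \<delta> * (real (card P) / 2)" by simp
  also have "\<dots> \<le> 2 * k * \<delta> * (\<Sum>z\<in>P. ?a z)"
    using total \<open>0 \<le> \<delta>\<close> by (intro mult_left_mono) auto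
  also have "\<dots> = (\<Sum>z\<in>P. 2 * k * \<delta> * ?a z)" by (rule sum_distrib_left)
  also have "\<dots> < (\<Sum>z\<in>P. ?d z)"
    using P(1) le bad[OF z] z(1) by (intro sum_strict_mono_ex1) blast+
  also have "\<dots> = (\<Sum>e\<in>A. \<Sum>z\<in>P. cmod (u (snd e) z - u (fst e) z))" by (rule sum.swap)
  also have "\<dots> \<le> card A * \<delta>"
    using sum_mono[of A _ "\<lambda>_. \<delta>", OF var] by simp
  also have "\<dots> \<le> k * card P * \<delta>"
    using A(2) \<open>0 \<le> \<delta>\<close> by (intro mult_right_mono) (auto simp flip: of_nat_mult)
  finally show False by simp
qed

text \<open>A unit mass on at most half of the points stays away from the constants.\<close>

lemma zero_sum_of_concentrated:
  fixes w :: "'v \<Rightarrow> real"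
  assumes P: "finite P" and nonneg: "\<And>x. x \<in> P \<Longrightarrow> 0 \<le> w x" and pos: "0 < (\<Sum>x\<in>P. w x)"
    and conc: "2 * card {x\<in>P. w x \<noteq> 0} \<le> card P"
  obtains g :: "'v \<Rightarrow> complex" where "\<forall>x. x \<notin> P \<longrightarrow> g x = 0" "(\<Sum>x\<in>P. g x) = 0"
    "1 / 2 \<le> (\<Sum>x\<in>P. cmod (g x))" "(\<Sum>x\<in>P. cmod (g x)) \<le> 2"
    "\<forall>x\<in>P. \<forall>y\<in>P. cmod (g y - g x) = \<bar>w y - w x\<bar> / (\<Sum>x\<in>P. w x)"
proof -
  define a where "a = (\<Sum>x\<in>P. w x)"
  define m where "m = 1 / real (card P)"
  \<comment> \<open>A probability vector minus the uniform one: the sum is zero, the norm is at most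
    2, and the constant \<open>m\<close> cancels in differences.\<close>
  define r where "r x = w x / a - m" for x
  define g where "g x = (if x \<in> P then complex_of_real (r x) else 0)" for x
  let ?Q = "{x\<in>P. w x \<noteq> 0}"
  have "P \<noteq> {}" using pos by auto
  then have card: "0 < card P" using P by (simp add: card_gt_0_iff)
  have a: "0 < a" using pos by (simp add: a_def)
  have one: "(\<Sum>x\<in>P. w x / a) = 1"
    using a by (simp add: a_def flip: sum_divide_distrib)
  have mass: "(\<Sum>x\<in>P. m) = 1" using P \<open>P \<noteq> {}\<close> by (simp add: m_def)
  have norm_g: "(\<Sum>x\<in>P. cmod (g x)) = (\<Sum>x\<in>P. \<bar>r x\<bar>)"
    by (intro sum.cong) (auto simp: g_def)
  show ?thesis
  proof (rule that[of g])
    show "(\<Sum>x\<in>P. g x) = 0"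
    proof -
      have "(\<Sum>x\<in>P. g x) = of_real (\<Sum>x\<in>P. r x)" by (simp add: g_def)
      also have "(\<Sum>x\<in>P. r x) = 0" unfolding r_def sum_subtractf one mass by simp
      finally show ?thesis by simp
    qed
    have "(\<Sum>x\<in>P. \<bar>r x\<bar>) \<le> (\<Sum>x\<in>P. w x / a + m)"
    proof (rule sum_mono)
      fix x assume "x \<in> P"
      then have "0 \<le> w x / a" "0 \<le> m" using nonneg a by (auto simp: m_def)
      then show "\<bar>r x\<bar> \<le> w x / a + m" unfolding r_def by linarith
    qed
    also have "\<dots> = 2" unfolding sum.distrib one mass by simp
    finally show "(\<Sum>x\<in>P. cmod (g x)) \<le> 2" by (simp add: norm_g)
    \<comment> \<open>The support \<open>?Q\<close> carries all the mass of \<open>w / a\<close> but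
      at most half of the uniform mass, so \<open>r\<close> already sums to at least
      \<open>1 / 2\<close> over it.\<close>
    have "(\<Sum>x\<in>?Q. w x / a) = 1"
      unfolding one[symmetric] using P by (intro sum.mono_neutral_left) auto
    moreover have "(\<Sum>x\<in>?Q. m) \<le> 1 / 2"
      using conc card by (simp add: m_def field_simps flip: of_nat_mult)
    ultimately have "1 / 2 \<le> (\<Sum>x\<in>?Q. r x)"
      by (simp add: r_def sum_subtractf)
    also have "\<dots> \<le> (\<Sum>x\<in>?Q. \<bar>r x\<bar>)" by (intro sum_mono) auto
    also have "\<dots> \<le> (\<Sum>x\<in>P. \<bar>r x\<bar>)" using P by (intro sum_mono2) auto
    finally show "1 / 2 \<le> (\<Sum>x\<in>P. cmod (g x))" by (simp add: norm_g)
    show "\<forall>x\<in>P. \<forall>y\<in>P. cmod (g y - g x) = \<bar>w y - w x\<bar> / (\<Sum>x\<in>P. w x)"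
    proof (intro ballI)
      fix x y assume "x \<in> P" "y \<in> P"
      then have "g y - g x = of_real ((w y - w x) / a)"
        by (simp add: g_def r_def diff_divide_distrib)
      then have "cmod (g y - g x) = \<bar>(w y - w x) / a\<bar>" by (simp only: norm_of_real)
      then show "cmod (g y - g x) = \<bar>w y - w x\<bar> / (\<Sum>x\<in>P. w x)"
        using a by (simp add: a_def)
    qed
  qed (simp add: g_def)
qed

section \<open>Controlled cochains\<close>

text \<open>A single point is a tuple of diameter 0, so the support radius belonging to
  \<open>R = 1\<close> serves all points at once.\<close>

lemma controlled_support:
  assumes "\<phi> \<in> vecs (controlled0 V)"
  obtains S where "0 < S" "\<forall>x. csupp V (\<phi> x) \<subseteq> ball x S"
proof -
  have "\<exists>S>0. \<forall>t\<in>tuples_within (\<lambda>x. {x}) 1. \<forall>x\<in>{t}. csupp V (\<phi> t) \<subseteq> ball x S"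
    using assms unfolding controlled0_def controlled_def by auto
  then show thesis using that by (auto simp: tuples_within_def)
qed

text \<open>Turns convergence of the seminorms into uniform pointwise smallness. Membership of each
  \<open>s n\<close> in the space supplies the boundedness that lets the supremum dominate its
  entries.\<close>

lemma null_seqs_controlled:
  assumes s: "s \<in> null_seqs (controlled pts V)" and "0 < \<delta>"
  shows "\<forall>\<^sub>F n in sequentially. \<forall>t\<in>tuples_within pts (real (Suc k)). cnorm V (s n t) < \<delta>"
proof -
  have bdd: "bdd_above ((\<lambda>t. cnorm V (s n t)) ` tuples_within pts (real (Suc k)))" for n
  proof -
    have "s n \<in> vecs (controlled pts V)" using s by (auto simp: null_seqs_def)
    then have "\<forall>R>0. bdd_above ((\<lambda>t. cnorm V (s n t)) ` tuples_within pts R)"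
      by (auto simp: controlled_def)
    then show ?thesis by (metis of_nat_0_less_iff zero_less_Suc)
  qed
  have "(\<lambda>n. SUP t\<in>tuples_within pts (real (Suc k)). cnorm V (s n t)) \<longlonglongrightarrow> 0"
    using s by (auto simp: null_seqs_def controlled_def)
  then have "\<forall>\<^sub>F n in sequentially. (SUP t\<in>tuples_within pts (real (Suc k)). cnorm V (s n t)) < \<delta>"
    using \<open>0 < \<delta>\<close> by (rule order_tendstoD)
  then show ?thesis
    by eventually_elim (use cSUP_upper[OF _ bdd] in \<open>fastforce intro: le_less_trans\<close>)
qed

lemma infsum_eq_sum:
  fixes f :: "'a \<Rightarrow> 'b::{topological_comm_monoid_add, t2_space}"
  assumes "finite P" "\<And>x. x \<notin> P \<Longrightarrow> f x = 0"
  shows "(\<Sum>\<^sub>\<infinity>x. f x) = (\<Sum>x\<in>P. f x)"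
proof -
  have "(\<Sum>\<^sub>\<infinity>x. f x) = (\<Sum>\<^sub>\<infinity>x\<in>P. f x)"
    using assms by (intro infsum_cong_neutral) auto
  then show ?thesis using assms by simp
qed

text \<open>
  The vanishing of \<open>D \<phi>\<close> and the normalisation of the sums are witnessed by different
  representatives \<open>u\<close> and \<open>v\<close> of the cocycle, each of them close to a third one, \<open>w\<close>.
\<close>

lemma approximate_cocycle:
  fixes \<phi> :: "(nat \<Rightarrow> 'v::metric_space \<Rightarrow> 'v \<Rightarrow> complex) set"
  assumes cocycle: "cocycle0 ell1 \<phi>" and pi: "pi_star \<phi> = one_Q" and "0 < \<delta>"
  obtains u v w :: "'v \<Rightarrow> 'v \<Rightarrow> complex" and S where "0 < S"
    "\<forall>x z. S \<le> dist x z \<longrightarrow> u x z = 0 \<and> v x z = 0 \<and> w x z = 0"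
    "\<forall>x y. dist x y \<le> 1 \<longrightarrow> (\<Sum>\<^sub>\<infinity>z. cmod (u y z - u x z)) < \<delta>"
    "\<forall>x. (\<Sum>\<^sub>\<infinity>z. cmod (w x z - u x z)) < \<delta>" "\<forall>x. (\<Sum>\<^sub>\<infinity>z. cmod (w x z - v x z)) < \<delta>"
    "\<forall>x. cmod ((\<Sum>\<^sub>\<infinity>z. v x z) - 1) < \<delta>"
proof -
  let ?E = "controlled0 ell1 :: ('v \<Rightarrow> 'v \<Rightarrow> complex) seminormed"
  let ?E1 = "controlled1 ell1 :: ('v \<times> 'v \<Rightarrow> 'v \<Rightarrow> complex) seminormed"
  let ?C = "controlled0 scalars :: ('v \<Rightarrow> complex) seminormed"
  obtain s where s: "s \<in> bounded_seqs ?E" "\<phi> = null_rel ?E `` {s}"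
    using cocycle by (auto simp: cocycle0_def quotient_completion_def elim: quotientE)
  \<comment> \<open>Tuples of this kind exist, so the supremum of the constant 0 is indeed
    0.\<close>
  have "(SUP t\<in>tuples_within (\<lambda>(x::'v, y). {x, y}) (1 + real k). 0 :: real) = 0" for k
    by (rule cSUP_const) (auto simp: tuples_within_def intro!: exI[of _ undefined])
  then have "(\<lambda>_. 0) \<in> qzero ?E1"
    by (auto simp: qzero_def qclass_def null_rel_def bounded_seqs_def null_seqs_def controlled1_def
        controlled_def ell1_def intro!: exI[of _ 1])
  \<comment> \<open>An equation of classes is used through a single member: the zero sequence lies
    on the right, hence in the union \<open>qmap\<close> on the left, which yields the
    representative \<open>p\<close>. The constant sequence 1 yields \<open>q\<close> in the same
    way.\<close>
  then obtain p where p: "p \<in> \<phi>" "(D0 \<circ> p, \<lambda>_. 0) \<in> null_rel ?E1"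
    using cocycle by (auto simp: cocycle0_def qmap_def qclass_def)
  have "(\<lambda>_ _. 1) \<in> (one_Q :: (nat \<Rightarrow> 'v \<Rightarrow> complex) set)"
    by (auto simp: one_Q_def qclass_def null_rel_def bounded_seqs_def null_seqs_def controlled0_def
        controlled_def scalars_def tuples_within_def intro!: exI[of _ 1])
  then obtain q where q: "q \<in> \<phi>" "((\<lambda>f. summation \<circ> f) \<circ> q, \<lambda>_ _. 1) \<in> null_rel ?C"
    using pi by (auto simp: pi_star_def qmap_def qclass_def)
  have pq: "(\<lambda>n. s n - p n) \<in> null_seqs ?E" "(\<lambda>n. s n - q n) \<in> null_seqs ?E"
    "p \<in> bounded_seqs ?E" "q \<in> bounded_seqs ?E"
    using p(1) q(1) s by (auto simp: null_rel_def)
  have "(\<lambda>n. D0 (p n)) \<in> null_seqs ?E1" "(\<lambda>n. (summation \<circ> q n) - (\<lambda>_. 1)) \<in> null_seqs ?C"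
    using p(2) q(2) by (auto simp: null_rel_def)
  note null = this pq(1,2)
  \<comment> \<open>Seminorm index 0 means radius 1, the scale of pairs of adjacent
    vertices.\<close>
  note ev = null[unfolded controlled0_def controlled1_def,
      THEN null_seqs_controlled[OF _ \<open>0 < \<delta>\<close>, of _ _ _ 0]]
  obtain n where n:
    "\<forall>t\<in>tuples_within (\<lambda>(x, y). {x, y}) (real (Suc 0)). cnorm ell1 (D0 (p n) t) < \<delta>"
    "\<forall>x::'v\<in>tuples_within (\<lambda>x. {x}) (real (Suc 0)).
      cnorm (scalars :: (complex, 'v) coeffs) (((summation \<circ> q n) - (\<lambda>_. 1)) x) < \<delta>"
    "\<forall>x\<in>tuples_within (\<lambda>x. {x}) (real (Suc 0)). cnorm ell1 ((s n - p n) x) < \<delta>"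
    "\<forall>x\<in>tuples_within (\<lambda>x. {x}) (real (Suc 0)). cnorm ell1 ((s n - q n) x) < \<delta>"
    using eventually_happens'[OF sequentially_bot eventually_conj[OF ev(1)
        eventually_conj[OF ev(2) eventually_conj[OF ev(3) ev(4)]]]]
    by (elim exE conjE) (rule that)
  have mem: "s n \<in> vecs ?E" "p n \<in> vecs ?E" "q n \<in> vecs ?E"
    using s pq by (auto simp: bounded_seqs_def)
  obtain S1 where S1: "0 < S1" "\<forall>x. csupp ell1 (s n x) \<subseteq> ball x S1"
    using controlled_support[OF mem(1)] .
  obtain S2 where S2: "0 < S2" "\<forall>x. csupp ell1 (p n x) \<subseteq> ball x S2"
    using controlled_support[OF mem(2)] .
  obtain S3 where S3: "0 < S3" "\<forall>x. csupp ell1 (q n x) \<subseteq> ball x S3"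
    using controlled_support[OF mem(3)] .
  show thesis
  proof (rule that[of "max S1 (max S2 S3)" "p n" "q n" "s n"])
    show "0 < max S1 (max S2 S3)" using S1(1) by simp
    show "\<forall>x z. max S1 (max S2 S3) \<le> dist x z \<longrightarrow> p n x z = 0 \<and> q n x z = 0 \<and> s n x z = 0"
    proof (intro allI impI)
      fix x z :: 'v assume "max S1 (max S2 S3) \<le> dist x z"
      then have "z \<notin> ball x S1" "z \<notin> ball x S2" "z \<notin> ball x S3" by auto
      then show "p n x z = 0 \<and> q n x z = 0 \<and> s n x z = 0"
        using S1(2)[rule_format, of x] S2(2)[rule_format, of x] S3(2)[rule_format, of x]
        by (auto simp: ell1_def)
    qed
    show "\<forall>x y. dist x y \<le> 1 \<longrightarrow> (\<Sum>\<^sub>\<infinity>z. cmod (p n y z - p n x z)) < \<delta>"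
    proof (intro allI impI)
      fix x y :: 'v assume "dist x y \<le> 1"
      then show "(\<Sum>\<^sub>\<infinity>z. cmod (p n y z - p n x z)) < \<delta>"
        using n(1)[rule_format, of "(x, y)"] by (simp add: tuples_within_def dist_commute D0_def ell1_def)
    qed
    show "\<forall>x. (\<Sum>\<^sub>\<infinity>z. cmod (s n x z - p n x z)) < \<delta>"
      "\<forall>x. (\<Sum>\<^sub>\<infinity>z. cmod (s n x z - q n x z)) < \<delta>"
      "\<forall>x. cmod ((\<Sum>\<^sub>\<infinity>z. q n x z) - 1) < \<delta>"
      using n(2-4) unfolding tuples_within_def by (simp_all add: ell1_def scalars_def summation_def)
  qed
qed

section \<open>From the cocycle to a non-zero Cheeger class\<close>

theorem theorem4p1:
  fixes \<Gamma> :: "nat \<Rightarrow> 'v::metric_space pair_pre_digraph"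
  assumes "\<And>i. pair_pseudo_graph (\<Gamma> i)"
    and "\<And>i. Digraph_Component.connected (with_proj (\<Gamma> i))"
    and "disjoint_family (\<lambda>i. pverts (\<Gamma> i))"
    and "(\<Union>i. pverts (\<Gamma> i)) = UNIV"
    and "\<exists>k. \<forall>i. \<forall>x\<in>pverts (\<Gamma> i). out_degree (with_proj (\<Gamma> i)) x \<le> k"
    and "\<And>(x::'v) r. compact (cball x r)"
    and "\<And>i x y. x \<in> pverts (\<Gamma> i) \<Longrightarrow> y \<in> pverts (\<Gamma> i) \<Longrightarrow>
           ereal (dist x y) = wf_digraph.\<mu> (with_proj (\<Gamma> i)) (\<lambda>_. 1) x y"
    and "filterlim (\<lambda>i. setdist (pverts (\<Gamma> i)) (- pverts (\<Gamma> i))) at_top sequentially"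
    and "filterlim (\<lambda>i. card (pverts (\<Gamma> i))) at_top sequentially"
    and "\<exists>\<phi>. cocycle0 (ell1 :: ('v \<Rightarrow> complex, 'v) coeffs) \<phi> \<and> pi_star \<phi> = one_Q"
  shows "\<exists>h\<in>cheeger_H0 \<Gamma>. h \<noteq> qzero (cheeger_C0 \<Gamma>)"
proof -
  obtain k where k: "\<And>i x. x \<in> pverts (\<Gamma> i) \<Longrightarrow> out_degree (with_proj (\<Gamma> i)) x \<le> k"
    using assms(5) by blast
  obtain \<phi> where \<phi>: "cocycle0 (ell1 :: ('v \<Rightarrow> complex, 'v) coeffs) \<phi>" "pi_star \<phi> = one_Q"
    using assms(10) by blast
  have nonempty: "pverts (\<Gamma> i) \<noteq> {}" for i
    using assms(2)[of i] by (auto simp: Digraph_Component.connected_def strongly_connected_def)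
  have ball: "card {y \<in> pverts (\<Gamma> i). dist x y \<le> real n} \<le> Suc k ^ n"
    if x: "x \<in> pverts (\<Gamma> i)" for i x n
  proof -
    interpret pair_pseudo_graph "\<Gamma> i" by (rule assms(1))
    have cost: "awalk_cost (\<lambda>_. 1) p = real (length p)" for p :: "('v \<times> 'v) list"
      by (induction p) auto
    have "{y \<in> pverts (\<Gamma> i). dist x y \<le> real n} \<subseteq> {y. \<exists>p. awalk x p y \<and> length p \<le> n}"
    proof safe
      fix y assume y: "y \<in> pverts (\<Gamma> i)" "dist x y \<le> real n"
      \<comment> \<open>The strict bound \<open>n + 1\<close> extracts a walk from the infimum
        defining \<mu>; integrality of its length brings the bound back to \<open>n\<close>.\<close>
      have "\<mu> (\<lambda>_. 1) x y < ereal (real (Suc n))"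
        using assms(7)[OF x y(1)] y(2) by (metis ereal_less_ereal_Ex le_less_trans less_ereal.simps(1) lessI of_nat_less_iff)
      then obtain p where "awalk x p y" "ereal (awalk_cost (\<lambda>_. 1) p) < ereal (real (Suc n))"
        unfolding \<mu>_def by (auto simp: INF_less_iff)
      then show "\<exists>p. awalk x p y \<and> length p \<le> n" by (auto simp: cost)
    qed
    moreover have "finite {y. \<exists>p. awalk x p y \<and> length p \<le> n}"
      by (rule finite_subset[OF _ pair_finite_verts]) (auto dest: awalk_last_in_verts)
    ultimately show ?thesis
      using card_walk_ball_le[OF k x, of n] card_mono le_trans by blast
  qed
  have arc_dist: "dist (fst e) (snd e) \<le> 1" if e: "e \<in> parcs (\<Gamma> i)" for i e
  proof -
    interpret pair_pseudo_graph "\<Gamma> i" by (rule assms(1))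
    have "\<mu> (\<lambda>_. 1) (fst e) (snd e) \<le> ereal (awalk_cost (\<lambda>_. 1) [e])"
      by (intro min_cost_le_walk_cost arc_implies_awalk e)
    then show ?thesis
      by (simp flip: assms(7)[OF arc_fst_in_verts[OF e] arc_snd_in_verts[OF e]])
  qed
  \<comment> \<open>Almost invariant vectors for every tolerance, with norm bounds that do not
    depend on it.\<close>
  have "\<exists>f. f \<in> vecs (cheeger_C0 \<Gamma>) \<and> 1 / 2 \<le> seminorm (cheeger_C0 \<Gamma>) 0 f
      \<and> seminorm (cheeger_C0 \<Gamma>) 0 f \<le> 2
      \<and> seminorm (cheeger_C1 \<Gamma>) 0 (coboundary \<Gamma> f) \<le> \<epsilon>" if "0 < \<epsilon>" for \<epsilon> :: real
  proof -
    \<comment> \<open>The value \<open>1 / 6\<close> ensures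
      \<open>1 - 3 * \<delta> \<ge> 1 / 2\<close> for the row masses; the other term ensures
      \<open>2 * k * \<delta> \<le> \<epsilon>\<close>, with \<open>k + 1\<close> keeping the
      divisor positive for \<open>k = 0\<close>.\<close>
    define \<delta> where "\<delta> = min (1 / 6) (\<epsilon> / (2 * (real k + 1)))"
    have \<delta>: "0 < \<delta>" "\<delta> \<le> 1 / 6" "\<delta> \<le> \<epsilon> / (2 * (real k + 1))"
      unfolding \<delta>_def using \<open>0 < \<epsilon>\<close> by (simp_all only: min.cobounded1 min.cobounded2) simp
    obtain u v w :: "'v \<Rightarrow> 'v \<Rightarrow> complex" and S where "0 < S"
      and supp: "\<forall>x z. S \<le> dist x z \<longrightarrow> u x z = 0 \<and> v x z = 0 \<and> w x z = 0"
      and var: "\<forall>x y. dist x y \<le> 1 \<longrightarrow> (\<Sum>\<^sub>\<infinity>z. cmod (u y z - u x z)) < \<delta>"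
      and wu: "\<forall>x. (\<Sum>\<^sub>\<infinity>z. cmod (w x z - u x z)) < \<delta>"
      and wv: "\<forall>x. (\<Sum>\<^sub>\<infinity>z. cmod (w x z - v x z)) < \<delta>"
      and mass: "\<forall>x. cmod ((\<Sum>\<^sub>\<infinity>z. v x z) - 1) < \<delta>"
      using approximate_cocycle[OF \<phi> \<delta>(1)] .
    define n where "n = nat \<lceil>S\<rceil>"
    \<comment> \<open>The radius \<open>S\<close> is fixed before \<open>i\<close>, so some
      component is both at distance at least \<open>S\<close> from the others and at least twice as
      large as the bound on its \<open>S\<close>-balls.\<close>
    obtain i where far: "S \<le> setdist (pverts (\<Gamma> i)) (- pverts (\<Gamma> i))"
      and large: "2 * Suc k ^ n \<le> card (pverts (\<Gamma> i))"
    proof -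
      have "\<forall>\<^sub>F i in sequentially. S \<le> setdist (pverts (\<Gamma> i)) (- pverts (\<Gamma> i))"
        "\<forall>\<^sub>F i in sequentially. 2 * Suc k ^ n \<le> card (pverts (\<Gamma> i))"
        using assms(8,9) by (auto simp: filterlim_at_top)
      from eventually_happens'[OF sequentially_bot eventually_conj[OF this]] that
      show ?thesis by blast
    qed
    define P A where "P = pverts (\<Gamma> i)" and "A = parcs (\<Gamma> i)"
    interpret pair_pseudo_graph "\<Gamma> i" by (rule assms(1))
    have fin: "finite P" "finite A" by (auto simp: P_def A_def pair_finite_verts pair_finite_arcs)
    have AP: "fst e \<in> P" "snd e \<in> P" if "e \<in> A" for e
      using that by (auto simp: P_def A_def arc_fst_in_verts arc_snd_in_verts)
    \<comment> \<open>Isolation of the component confines the rows over \<open>P\<close> to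
      \<open>P\<close>, so the infinite sums become finite.\<close>
    have outside: "u x z = 0" "v x z = 0" "w x z = 0" if "x \<in> P" "z \<notin> P" for x z
      using that supp[rule_format, of x z] far setdist_le_dist[of x P z "- P"] by (auto simp: P_def)
    \<comment> \<open>The normalisation of \<open>v\<close> costs one \<delta>, and the passage from
      \<open>v\<close> through \<open>w\<close> to \<open>u\<close> costs two more.\<close>
    have mass_u: "1 / 2 \<le> (\<Sum>z\<in>P. cmod (u x z))" if x: "x \<in> P" for x
    proof -
      note o = outside[OF x]
      have 1: "(\<Sum>z\<in>P. cmod (w x z - u x z)) < \<delta>"
        using wu[rule_format, of x] infsum_eq_sum[OF fin(1), of "\<lambda>z. cmod (w x z - u x z)"] o by simp
      have 2: "(\<Sum>z\<in>P. cmod (w x z - v x z)) < \<delta>"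
        using wv[rule_format, of x] infsum_eq_sum[OF fin(1), of "\<lambda>z. cmod (w x z - v x z)"] o by simp
      have 3: "cmod ((\<Sum>z\<in>P. v x z) - 1) < \<delta>"
        using mass[rule_format, of x] infsum_eq_sum[OF fin(1), of "v x"] o by simp
      have "1 - \<delta> \<le> cmod (\<Sum>z\<in>P. v x z)"
        using norm_triangle_ineq2[of 1 "\<Sum>z\<in>P. v x z"] 3 by (simp add: norm_minus_commute)
      also have "\<dots> \<le> (\<Sum>z\<in>P. cmod (v x z))" by (rule norm_sum)
      also have "\<dots> \<le> (\<Sum>z\<in>P. cmod (u x z) + cmod (w x z - u x z) + cmod (w x z - v x z))"
      proof (rule sum_mono)
        fix z
        have "v x z = u x z + (w x z - u x z) - (w x z - v x z)" by simp
        then show "cmod (v x z) \<le> cmod (u x z) + cmod (w x z - u x z) + cmod (w x z - v x z)"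
          by (metis add_right_mono norm_triangle_ineq norm_triangle_ineq4 order_trans)
      qed
      finally show ?thesis using 1 2 \<delta> by (simp add: sum.distrib)
    qed
    have var_u: "(\<Sum>z\<in>P. cmod (u (snd e) z - u (fst e) z)) \<le> \<delta>" if e: "e \<in> A" for e
      using var[rule_format, OF arc_dist] e AP[OF e] outside(1)
        infsum_eq_sum[OF fin(1), of "\<lambda>z. cmod (u (snd e) z - u (fst e) z)"]
      by (fastforce simp: A_def)
    have card_A: "card A \<le> k * card P"
      unfolding A_def P_def by (rule card_arcs_le) (rule k)
    obtain z where z: "z \<in> P" "0 < (\<Sum>x\<in>P. cmod (u x z))"
      "(\<Sum>e\<in>A. cmod (u (snd e) z - u (fst e) z)) \<le> 2 * k * \<delta> * (\<Sum>x\<in>P. cmod (u x z))"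
      using almost_invariant_column[OF fin(1) _ fin(2) card_A mass_u var_u] nonempty[of i] \<delta>(1)
      by (auto simp: P_def)
    \<comment> \<open>The support condition concerns rows; by symmetry of the distance it also
      confines the column to the \<open>S\<close>-ball about \<open>z\<close>, which has at most
      half of the points of \<open>P\<close>.\<close>
    have "card {x\<in>P. cmod (u x z) \<noteq> 0} \<le> card {x\<in>P. dist z x \<le> real n}"
    proof (rule card_mono)
      show "{x\<in>P. cmod (u x z) \<noteq> 0} \<subseteq> {x\<in>P. dist z x \<le> real n}"
      proof safe
        fix x assume "cmod (u x z) \<noteq> 0"
        then have "dist x z < S" using supp[rule_format, of x z] by force
        then show "dist z x \<le> real n" unfolding n_def dist_commute[of z] by linarith
      qed
    qed (simp add: fin)
    also have "\<dots> \<le> Suc k ^ n" using ball z(1) by (simp add: P_def)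
    finally have conc: "2 * card {x\<in>P. cmod (u x z) \<noteq> 0} \<le> card P" using large by (simp add: P_def)
    obtain g :: "'v \<Rightarrow> complex" where g: "\<forall>x. x \<notin> P \<longrightarrow> g x = 0" "(\<Sum>x\<in>P. g x) = 0"
      "1 / 2 \<le> (\<Sum>x\<in>P. cmod (g x))" "(\<Sum>x\<in>P. cmod (g x)) \<le> 2"
      "\<forall>x\<in>P. \<forall>y\<in>P. cmod (g y - g x) = \<bar>cmod (u y z) - cmod (u x z)\<bar> / (\<Sum>x\<in>P. cmod (u x z))"
      using zero_sum_of_concentrated[where w = "\<lambda>x. cmod (u x z)", OF fin(1) norm_ge_zero z(2) conc] .
    have g_C0: "g \<in> vecs (cheeger_C0 \<Gamma>)"
      "seminorm (cheeger_C0 \<Gamma>) 0 g = (\<Sum>x\<in>P. cmod (g x))"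
      using zero_sum_space_single[OF assms(3), of i g] g(1,2) by (auto simp: cheeger_C0_def P_def)
    have "(\<Sum>e\<in>parcs (\<Gamma> j). cmod (coboundary \<Gamma> g e)) \<le> \<epsilon>" for j
    proof (cases "j = i")
      case True
      have "(\<Sum>e\<in>A. cmod (coboundary \<Gamma> g e))
          \<le> (\<Sum>e\<in>A. cmod (u (snd e) z - u (fst e) z) / (\<Sum>x\<in>P. cmod (u x z)))"
      proof (rule sum_mono)
        fix e assume e: "e \<in> A"
        then have "cmod (coboundary \<Gamma> g e) = cmod (g (snd e) - g (fst e))"
          by (auto simp: coboundary_def A_def)
        also have "\<dots> = \<bar>cmod (u (snd e) z) - cmod (u (fst e) z)\<bar> / (\<Sum>x\<in>P. cmod (u x z))"
          by (rule g(5)[rule_format, OF AP[OF e]])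
        \<comment> \<open>The reverse triangle inequality: taking absolute values does not increase
          the variation along an arc.\<close>
        also have "\<dots> \<le> cmod (u (snd e) z - u (fst e) z) / (\<Sum>x\<in>P. cmod (u x z))"
          by (intro divide_right_mono norm_triangle_ineq3 less_imp_le[OF z(2)])
        finally show "cmod (coboundary \<Gamma> g e)
            \<le> cmod (u (snd e) z - u (fst e) z) / (\<Sum>x\<in>P. cmod (u x z))" .
      qed
      also have "\<dots> \<le> 2 * k * \<delta>"
        using z(2,3) by (simp add: divide_le_eq flip: sum_divide_distrib)
      also have "\<dots> \<le> 2 * (real k + 1) * \<delta>" using \<delta>(1) by simp
      also have "\<dots> \<le> \<epsilon>" using \<delta>(3) by (simp add: field_simps)
      finally show ?thesis using True by (simp add: A_def)
    next
      case False
      have "g x = 0" if "x \<in> pverts (\<Gamma> j)" for x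
        using g(1)[rule_format, of x] that assms(3) False by (auto simp: P_def disjoint_family_on_def)
      then have "(\<Sum>x\<in>pverts (\<Gamma> j). cmod (g x)) = 0" by simp
      \<comment> \<open>On any other component \<open>g\<close> has mass zero, and the coboundary is
        bounded by a multiple of that mass.\<close>
      then show ?thesis
        using sum_norm_coboundary_le[where \<Gamma> = \<Gamma> and i = j and f = g, OF assms(1) k] \<open>0 < \<epsilon>\<close> by simp
    qed
    then have "seminorm (cheeger_C1 \<Gamma>) 0 (coboundary \<Gamma> g) \<le> \<epsilon>"
      by (auto simp: cheeger_C1_def zero_sum_space_def intro!: cSUP_least)
    then show ?thesis using g_C0 g(3,4) by auto
  qed
  \<comment> \<open>The tolerance \<open>1 / (n + 1)\<close> gives the term with index
    \<open>n\<close> of the representing sequence; the component carrying it may vary with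
    \<open>n\<close>.\<close>
  then have "\<forall>n. \<exists>f. f \<in> vecs (cheeger_C0 \<Gamma>) \<and> 1 / 2 \<le> seminorm (cheeger_C0 \<Gamma>) 0 f
      \<and> seminorm (cheeger_C0 \<Gamma>) 0 f \<le> 2
      \<and> seminorm (cheeger_C1 \<Gamma>) 0 (coboundary \<Gamma> f) \<le> 1 / real (Suc n)"
    by simp
  then obtain f where f: "\<And>n. f n \<in> vecs (cheeger_C0 \<Gamma>)"
    "\<And>n. 1 / 2 \<le> seminorm (cheeger_C0 \<Gamma>) 0 (f n)" "\<And>n. seminorm (cheeger_C0 \<Gamma>) 0 (f n) \<le> 2"
    "\<And>n. seminorm (cheeger_C1 \<Gamma>) 0 (coboundary \<Gamma> (f n)) \<le> 1 / real (Suc n)"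
    by metis
  have lim: "(\<lambda>n. seminorm (cheeger_C1 \<Gamma>) 0 (coboundary \<Gamma> (f n))) \<longlonglongrightarrow> 0"
  proof (rule tendsto_sandwich[OF _ _ tendsto_const LIMSEQ_Suc[OF lim_1_over_n]])
    interpret C1: seminormed_space "cheeger_C1 \<Gamma>"
      unfolding cheeger_C1_def by (rule seminormed_space_zero_sum_space)
    show "\<forall>\<^sub>F n in sequentially. 0 \<le> seminorm (cheeger_C1 \<Gamma>) 0 (coboundary \<Gamma> (f n))"
      using C1.seminorm_nonneg coboundary_bound(1)[OF assms(1) k f(1)] by simp
  qed (use f(4) in simp)
  show ?thesis
    by (rule cheeger_H0_nonzero[where s = f and c = "1 / 2" and b = 2, OF assms(1) k f(1) _ f(2,3) lim]) auto
qed

end
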